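(* Let $\mathbb{F}$ be a field and let $p,q$ be split non-derogatory polynomials in $\mathbb{F}[t]$ with degree $2$. Then every elementary automorphism $u$ of an $\mathbb{F}$-vector space $V$ is a $(p,q)$-product in $\mathrm{End}(V)$.
   Context: A polynomial $p\in\mathbb{F}[t]$ is called non-derogatory if $p(0)\neq 0$. An element $x$ of a (unital associative) $\mathbb{F}$-algebra $\mathcal{A}$ is a $(p,q)$-product if $x=ab$ for some $a,b\in\mathcal{A}$ with $p(a)=0$ and $q(b)=0$. An automorphism $u$ of a vector space $V$ makes $V$ an $\mathbb{F}[t,t^{-1}]$-module, denoted $V^u$, with $t\cdot x=u(x)$ for all $x\in V$. The automorphism $u$ is called elementary if $V^u$ is a free $\mathbb{F}[t,t^{-1}]$-module; equivalently, $u$ is a direct sum of super-elementary automorphisms, where an automorphism $v$ of a vector space $W$ is super-elementary if $W$ has a basis $(e_k)_{k\in\mathbb{Z}}$ with $v(e_k)=e_{k+1}$ for all $k\in\mathbb{Z}$. *)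

theory Defs
  imports "HOL-Library.Poly_Mapping" "HOL-Computational_Algebra.Polynomial"
begin

definition split_poly :: "'a::field poly \<Rightarrow> bool" where
  "split_poly p \<longleftrightarrow> (\<exists>c rs. p = smult c (\<Prod>r\<leftarrow>rs. [:- r, 1:]))"

definition non_derogatory :: "'a::field poly \<Rightarrow> bool" where
  "non_derogatory p \<longleftrightarrow> poly p 0 \<noteq> 0"

text \<open>Vector spaces are given by their scalar multiplication, the underlying set being the
  whole type. The algebra of endomorphisms consists of the linear functions on that type,
  multiplied by composition.\<close>

definition automorphism :: "('a::field \<Rightarrow> 'b::ab_group_add \<Rightarrow> 'b) \<Rightarrow> ('b \<Rightarrow> 'b) \<Rightarrow> bool" where
  "automorphism scale u \<longleftrightarrow> Vector_Spaces.linear scale scale u \<and> bij u"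

definition poly_endo :: "('a::field \<Rightarrow> 'b::ab_group_add \<Rightarrow> 'b) \<Rightarrow> 'a poly \<Rightarrow> ('b \<Rightarrow> 'b) \<Rightarrow> 'b \<Rightarrow> 'b" where
  "poly_endo scale p f = (\<lambda>x. \<Sum>i\<le>degree p. scale (coeff p i) ((f ^^ i) x))"

definition pq_product_endo ::
  "('a::field \<Rightarrow> 'b::ab_group_add \<Rightarrow> 'b) \<Rightarrow> 'a poly \<Rightarrow> 'a poly \<Rightarrow> ('b \<Rightarrow> 'b) \<Rightarrow> bool" where
  "pq_product_endo scale p q u \<longleftrightarrow>
     (\<exists>a b. Vector_Spaces.linear scale scale a \<and> Vector_Spaces.linear scale scale b \<and>
        u = a \<circ> b \<and> poly_endo scale p a = (\<lambda>_. 0) \<and> poly_endo scale q b = (\<lambda>_. 0))"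

definition int_iter :: "('b \<Rightarrow> 'b) \<Rightarrow> int \<Rightarrow> 'b \<Rightarrow> 'b" where
  "int_iter u k = (if 0 \<le> k then u ^^ nat k else inv u ^^ nat (- k))"

text \<open>The ring of Laurent polynomials over \<open>'a\<close> is the group ring \<open>int \<Rightarrow>\<^sub>0 'a\<close> (finitely supported
  functions with convolution), where \<open>Poly_Mapping.single k c\<close> is the monomial with coefficient
  \<open>c\<close> and exponent \<open>k\<close>.\<close>

definition laurent_scale ::
  "('a::field \<Rightarrow> 'b::ab_group_add \<Rightarrow> 'b) \<Rightarrow> ('b \<Rightarrow> 'b) \<Rightarrow> (int \<Rightarrow>\<^sub>0 'a) \<Rightarrow> 'b \<Rightarrow> 'b" where
  "laurent_scale scale u f x =
     (\<Sum>k\<in>Poly_Mapping.keys f. scale (Poly_Mapping.lookup f k) (int_iter u k x))"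

definition free_module :: "('r::comm_ring_1 \<Rightarrow> 'b::ab_group_add \<Rightarrow> 'b) \<Rightarrow> bool" where
  "free_module s \<longleftrightarrow>
     module s \<and> (\<exists>B. \<not> module.dependent s B \<and> module.span s B = UNIV)"

definition elementary :: "('a::field \<Rightarrow> 'b::ab_group_add \<Rightarrow> 'b) \<Rightarrow> ('b \<Rightarrow> 'b) \<Rightarrow> bool" where
  "elementary scale u \<longleftrightarrow> automorphism scale u \<and> free_module (laurent_scale scale u)"


text \<open>For an automorphism \<open>u\<close>, \<open>laurent_scale scale u\<close> always defines a module, and the
  indeterminate acts as \<open>u\<close>.\<close>

lemma int_iter_succ:
  assumes "bij u" shows "int_iter u (k + 1) x = u (int_iter u k x)"
proof (cases "0 \<le> k")
  case True
  then show ?thesis by (simp add: int_iter_def nat_add_distrib)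
next
  case False
  then have "nat (- k) = Suc (nat (- (k + 1)))" by simp
  then have "(inv u ^^ nat (- k)) x = inv u ((inv u ^^ nat (- (k + 1))) x)"
    by simp
  moreover have "u (inv u y) = y" for y
    using assms by (simp add: bij_is_surj surj_f_inv_f)
  moreover have "int_iter u (k + 1) = inv u ^^ nat (- (k + 1))"
    using False by (cases "k = - 1") (auto simp: int_iter_def)
  ultimately show ?thesis using False by (simp add: int_iter_def del: funpow.simps)
qed

lemma int_iter_add:
  assumes "bij u" shows "int_iter u (j + k) x = int_iter u j (int_iter u k x)"
proof (induction j rule: int_induct[where k = 0])
  case base
  then show ?case by (simp add: int_iter_def)
next
  case (step1 i)
  have "i + 1 + k = i + k + 1" by simp
  then show ?case using step1 int_iter_succ[OF assms] by metis
next
  case (step2 i)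
  have "u (int_iter u (i - 1 + k) x) = int_iter u (i + k) x"
    using int_iter_succ[OF assms, of "i - 1 + k" x] by (simp add: algebra_simps)
  moreover have "u (int_iter u (i - 1) (int_iter u k x)) = int_iter u i (int_iter u k x)"
    using int_iter_succ[OF assms, of "i - 1" "int_iter u k x"] by simp
  ultimately have "u (int_iter u (i - 1 + k) x) = u (int_iter u (i - 1) (int_iter u k x))"
    using step2 by simp
  then show ?case using bij_is_inj[OF assms] by (simp add: inj_eq)
qed

lemma linear_int_iter:
  assumes "automorphism scale u" shows "Vector_Spaces.linear scale scale (int_iter u k)"
proof -
  interpret l: Vector_Spaces.linear scale scale u
    using assms by (simp add: automorphism_def)
  have b: "bij u" using assms by (simp add: automorphism_def)
  have u_inv: "u (inv u y) = y" for y
    using b by (simp add: bij_is_surj surj_f_inv_f)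
  have i_add: "inv u (x + y) = inv u x + inv u y" for x y
    by (rule injD[OF bij_is_inj[OF b]]) (simp add: l.add u_inv)
  have i_scale: "inv u (scale c x) = scale c (inv u x)" for c x
    by (rule injD[OF bij_is_inj[OF b]]) (simp add: l.scale u_inv)
  have p: "(u ^^ n) (x + y) = (u ^^ n) x + (u ^^ n) y"
      "(u ^^ n) (scale c x) = scale c ((u ^^ n) x)"
      "(inv u ^^ n) (x + y) = (inv u ^^ n) x + (inv u ^^ n) y"
      "(inv u ^^ n) (scale c x) = scale c ((inv u ^^ n) x)" for n x y c
    by (induction n) (simp_all add: l.add l.scale i_add i_scale)
  show ?thesis
    by unfold_locales (simp_all add: int_iter_def p)
qed

lemma laurent_scale_superset:
  assumes "vector_space scale" "finite A" "Poly_Mapping.keys f \<subseteq> A"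
  shows "laurent_scale scale u f x =
    (\<Sum>k\<in>A. scale (Poly_Mapping.lookup f k) (int_iter u k x))"
proof -
  interpret vector_space scale by fact
  show ?thesis
    unfolding laurent_scale_def
    by (rule sum.mono_neutral_left) (use assms in \<open>auto simp: in_keys_iff\<close>)
qed

lemma laurent_scale_single:
  assumes "vector_space scale"
  shows "laurent_scale scale u (Poly_Mapping.single k c) x = scale c (int_iter u k x)"
  by (subst laurent_scale_superset[OF assms, where A = "{k}"]) auto

lemma laurent_scale_indeterminate:
  assumes "vector_space scale"
  shows "laurent_scale scale u (Poly_Mapping.single 1 1) = u"
  by (simp add: fun_eq_iff laurent_scale_single assms int_iter_def
      vector_space.vector_space_assms)

lemma laurent_scale_add_left:
  assumes "vector_space scale"
  shows "laurent_scale scale u (f + g) x = laurent_scale scale u f x + laurent_scale scale u g x"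
proof -
  interpret vector_space scale by fact
  let ?A = "Poly_Mapping.keys f \<union> Poly_Mapping.keys g"
  have "Poly_Mapping.keys (f + g) \<subseteq> ?A" by (rule Poly_Mapping.keys_add)
  then show ?thesis
    by (simp add: laurent_scale_superset[OF assms, where A = ?A] lookup_add
        scale_left_distrib sum.distrib)
qed

lemma poly_mapping_single_induct [case_names zero single_add]:
  fixes f :: "'k \<Rightarrow>\<^sub>0 'v::comm_monoid_add"
  assumes "P 0" "\<And>k c f. P f \<Longrightarrow> P (Poly_Mapping.single k c + f)"
  shows "P f"
proof (induction f rule: update_induct)
  case const
  then show ?case by (rule assms)
next
  case (update f k c)
  have "Poly_Mapping.update k c f = Poly_Mapping.single k c + f"
    using update
    by (intro poly_mapping_eqI)
      (auto simp: lookup_update lookup_add lookup_single when_def in_keys_iff)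
  with assms(2) update show ?case by simp
qed

lemma module_laurent_scale:
  assumes "automorphism scale u"
  shows "module (laurent_scale scale u)"
proof -
  interpret l: Vector_Spaces.linear scale scale u
    using assms by (simp add: automorphism_def)
  have vs: "vector_space scale" ..
  have b: "bij u" using assms by (simp add: automorphism_def)
  let ?s = "laurent_scale scale u"
  have it: "int_iter u k (x + y) = int_iter u k x + int_iter u k y"
     "int_iter u k (scale c x) = scale c (int_iter u k x)" for k x y c
    using module_hom.add module_hom.scale linear_int_iter[OF assms, of k]
    unfolding Vector_Spaces.linear_def by blast+
  have add_right: "?s f (x + y) = ?s f x + ?s f y" for f x y
    by (simp add: laurent_scale_def it l.vs1.scale_right_distrib sum.distrib)
  note add_left = laurent_scale_add_left[OF vs]
  note single = laurent_scale_single[OF vs]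
  have zero_left: "?s 0 x = 0" for x by (simp add: laurent_scale_def)
  have single_mult: "?s (Poly_Mapping.single k c) (?s g x) = ?s (Poly_Mapping.single k c * g) x"
    for k c g x
  proof (induction g rule: poly_mapping_single_induct)
    case zero
    have "?s f 0 = 0" for f using add_right[of f 0 0] by simp
    then show ?case by (simp add: zero_left)
  next
    case (single_add j d g)
    then show ?case
      by (simp add: distrib_left add_left add_right mult_single)
        (simp add: single it int_iter_add[OF b])
  qed
  have mult: "?s f (?s g x) = ?s (f * g) x" for f g x
    by (induction f rule: poly_mapping_single_induct)
      (simp_all add: zero_left add_left single_mult distrib_right)
  have one: "?s 1 x = x" for x
    using single[of u 0 1 x] by (simp add: int_iter_def)
  show ?thesis
    by unfold_locales (rule add_right add_left mult one)+
qed

end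

theory Submission
  imports Defs
begin

text \<open>Write \<open>p = \<ell> (t\<^sup>2 - s t + d)\<close> and \<open>q = m (t - y\<^sub>1) (t - y\<^sub>2)\<close>, and put \<open>c = d y\<^sub>1 y\<^sub>2\<close>.
  On Laurent polynomials let \<open>\<sigma>\<close> be the involution \<open>t \<mapsto> c / t\<close> and let \<open>D\<close> be the Demazure operator
  \<open>D f = (f - \<sigma> f) / (t - c / t)\<close>. Imitating the Demazure-Lusztig operators of affine Hecke algebras,
  one takes \<open>b = y\<^sub>1 + w D\<close> and \<open>a = t b\<^sup>-\<^sup>1\<close> with \<open>w = c y\<^sub>1 t\<^sup>-\<^sup>1 + y\<^sub>2 t - s y\<^sub>1 y\<^sub>2\<close>. All that the
  computation uses of \<open>D\<close> are the relations \<open>D t = c t\<^sup>-\<^sup>1 D + 1\<close> and \<open>D\<^sup>2 = 0\<close>, so on a free module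
  \<open>D\<close> is defined by the first relation and by \<open>D = 0\<close> on a basis; then \<open>D\<^sup>2\<close> commutes with \<open>t\<close>
  and kills the basis, hence vanishes.\<close>

section \<open>Linear maps and two-sided recursion\<close>

lemma linearI:
  assumes "vector_space s1" "vector_space s2"
    and "\<And>x y. f (x + y) = f x + f y" "\<And>r x. f (s1 r x) = s2 r (f x)"
  shows "Vector_Spaces.linear s1 s2 f"
  using assms by (simp add: Vector_Spaces.linear_iff)

text \<open>Below 0 the sequence is built by choosing preimages: \<open>N (Suc n)\<close> inverts
  \<open>g\<close> at index \<open>- n - 1\<close>, the step leading from \<open>- n - 1\<close> to
  \<open>- n\<close>.\<close>

lemma int_recursion:
  fixes g :: "int \<Rightarrow> 'x \<Rightarrow> 'x"
  assumes "\<And>k. surj (g k)"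
  obtains f where "f 0 = x" "\<And>k. f (k + 1) = g k (f k)"
proof -
  define P where "P = rec_nat x (\<lambda>n. g (int n))"
  define N where "N = rec_nat x (\<lambda>n. inv (g (- int n - 1)))"
  define f where "f k = (if 0 \<le> k then P (nat k) else N (nat (- k)))" for k
  have "f (k + 1) = g k (f k)" for k
  proof (cases "0 \<le> k")
    case True
    then show ?thesis by (simp add: f_def P_def nat_add_distrib)
  next
    case False
    define n where "n = nat (- k - 1)"
    have k: "k = - int n - 1" and nk: "nat (- k) = Suc n"
      using False by (auto simp: n_def)
    have "f (k + 1) = N n"
      using k by (cases "n = 0") (auto simp: f_def P_def N_def)
    moreover have "f k = inv (g k) (N n)"
      using False nk k by (simp add: f_def N_def)
    ultimately show ?thesis
      by (simp add: surj_f_inv_f[OF assms])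
  qed
  moreover have "f 0 = x" by (simp add: f_def P_def)
  ultimately show ?thesis using that by blast
qed

section \<open>From a Laurent basis to a basis over the field\<close>

text \<open>Applying \<open>\<phi> i\<close> to a vanishing combination isolates the coefficient of
  \<open>e i\<close>.\<close>

lemma biorthogonal_independent:
  assumes "vector_space scale"
    and lin: "\<And>i. i \<in> I \<Longrightarrow> Vector_Spaces.linear scale (*) (\<phi> i)"
    and bi: "\<And>i j. i \<in> I \<Longrightarrow> j \<in> I \<Longrightarrow> \<phi> i (e j) = (if i = j then 1 else 0)"
  shows "inj_on e I" and "\<not> module.dependent scale (e ` I)"
proof -
  interpret vector_space scale by fact
  show inj: "inj_on e I"
    by (rule inj_onI) (metis bi zero_neq_one)
  show "\<not> dependent (e ` I)"
    unfolding independent_explicit_module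
  proof (intro allI impI)
    fix T f v
    assume T: "finite T" "T \<subseteq> e ` I" "(\<Sum>v\<in>T. scale (f v) v) = 0" "v \<in> T"
    then obtain i where i: "i \<in> I" "v = e i" by blast
    interpret l: Vector_Spaces.linear scale "(*)" "\<phi> i" using lin i by blast
    have "0 = (\<Sum>v\<in>T. f v * \<phi> i v)"
      using arg_cong[OF T(3), of "\<phi> i"] by (simp add: l.sum l.scale l.zero)
    also have "\<dots> = (\<Sum>w\<in>T. if w = v then f w else 0)"
      using T(2) i inj by (intro sum.cong) (auto simp: bi inj_on_eq_iff)
    also have "\<dots> = f v" using T by simp
    finally show "f v = 0" by simp
  qed
qed

text \<open>Reading off the coefficient of t^k in the coordinate at \<beta> gives functionals
  biorthogonal to \<open>e\<close>, whence independence. Splitting coordinates into monomials gives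
  spanning.\<close>

lemma vector_space_basis_of_laurent_basis:
  assumes vs: "vector_space scale" and u: "automorphism scale u"
    and ind: "\<not> module.dependent (laurent_scale scale u) B"
    and span: "module.span (laurent_scale scale u) B = UNIV"
  defines "e \<equiv> \<lambda>(k, \<beta>). int_iter u k \<beta>"
  shows "inj_on e (UNIV \<times> B)"
    and "\<not> module.dependent scale (e ` (UNIV \<times> B))"
    and "module.span scale (e ` (UNIV \<times> B)) = UNIV"
proof -
  interpret v: vector_space scale by fact
  interpret m: module "laurent_scale scale u" by (rule module_laurent_scale[OF u])
  note single = laurent_scale_single[OF vs]
  have vs_field: "vector_space ((*) :: 'a \<Rightarrow> 'a \<Rightarrow> 'a)"
    by unfold_locales (simp_all add: algebra_simps)
  let ?R = "m.representation B"
  \<comment> \<open>Scalars act as constant Laurent polynomials, so the coordinates are linear over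
    the field.\<close>
  have scale: "scale r x = laurent_scale scale u (Poly_Mapping.single 0 r) x" for r x
    by (simp add: single int_iter_def)
  define \<phi> where "\<phi> = (\<lambda>(k :: int, \<beta>) x. Poly_Mapping.lookup (?R x \<beta>) k)"
  have lookup0: "Poly_Mapping.lookup (Poly_Mapping.single 0 r * f) k = r * Poly_Mapping.lookup f k"
    for r and f :: "int \<Rightarrow>\<^sub>0 'a" and k
    by (induction f rule: poly_mapping_single_induct)
      (simp_all add: distrib_left lookup_add mult_single lookup_single when_def)
  have lin: "Vector_Spaces.linear scale (*) (\<phi> i)" for i
  proof -
    obtain k \<beta> where i: "i = (k, \<beta>)" by (cases i)
    have "\<phi> i (x + y) = \<phi> i x + \<phi> i y" for x y
      by (simp add: \<phi>_def i m.representation_add[OF ind] span lookup_add)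
    moreover have "\<phi> i (scale r x) = r * \<phi> i x" for r x
      by (simp add: \<phi>_def i scale m.representation_scale[OF ind] span lookup0)
    ultimately show ?thesis
      by (rule linearI[OF vs vs_field])
  qed
  have bi: "\<phi> i (e j) = (if i = j then 1 else 0)" if "i \<in> UNIV \<times> B" "j \<in> UNIV \<times> B" for i j
  proof -
    obtain k \<beta> where i: "i = (k, \<beta>)" by (cases i)
    obtain l \<gamma> where j: "j = (l, \<gamma>)" by (cases j)
    have "e j = laurent_scale scale u (Poly_Mapping.single l 1) \<gamma>"
      by (simp add: e_def j single)
    then show ?thesis
      using that by (simp add: \<phi>_def i j m.representation_scale[OF ind] span
          m.representation_basis[OF ind] lookup_single when_def)
  qed
  show "inj_on e (UNIV \<times> B)" "\<not> v.dependent (e ` (UNIV \<times> B))"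
    using biorthogonal_independent[where \<phi> = \<phi>, OF vs lin bi] by blast+
  let ?S = "v.span (e ` (UNIV \<times> B))"
  have "x \<in> ?S" for x
  proof -
    have "x = (\<Sum>\<beta> | ?R x \<beta> \<noteq> 0. laurent_scale scale u (?R x \<beta>) \<beta>)"
      using m.sum_nonzero_representation_eq[OF ind] span by simp
    also have "\<dots> \<in> ?S"
    proof (rule v.span_sum)
      fix \<beta> assume "\<beta> \<in> {\<beta>. ?R x \<beta> \<noteq> 0}"
      then have "\<beta> \<in> B" by (auto intro: m.representation_ne_zero)
      then have "int_iter u k \<beta> \<in> e ` (UNIV \<times> B)" for k by (force simp: e_def)
      then show "laurent_scale scale u f \<beta> \<in> ?S" for f
        unfolding laurent_scale_def by (intro v.span_sum v.span_scale v.span_base)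
    qed
    finally show ?thesis .
  qed
  then show "?S = UNIV" by blast
qed

section \<open>The Demazure operator\<close>

lemma demazure_operator_exists:
  assumes vs: "vector_space scale" and el: "elementary scale u" and c: "c \<noteq> 0"
  obtains D where "Vector_Spaces.linear scale scale D"
    "\<And>x. D (u x) = scale c (inv u (D x)) + x" "\<And>x. D (D x) = 0"
proof -
  have u: "automorphism scale u" and bij: "bij u"
    using el by (auto simp: elementary_def automorphism_def)
  interpret v: vector_space scale by fact
  interpret u: Vector_Spaces.linear scale scale u using u by (simp add: automorphism_def)
  have ui: "u (inv u x) = x" and iu: "inv u (u x) = x" for x
    using bij by (simp_all add: bij_is_surj bij_is_inj surj_f_inv_f)
  have "int_iter u (- 1) = inv u" by (simp add: int_iter_def)
  then interpret i: Vector_Spaces.linear scale scale "inv u"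
    using linear_int_iter[OF u, of "- 1"] by simp
  obtain B where B: "\<not> module.dependent (laurent_scale scale u) B"
    "module.span (laurent_scale scale u) B = UNIV"
    using el by (auto simp: elementary_def free_module_def)
  define e where "e = (\<lambda>(k, \<beta>). int_iter u k \<beta>)"
  note basis = vector_space_basis_of_laurent_basis[OF vs u B, folded e_def]
  \<comment> \<open>Here \<open>f k\<close> is the intended value of \<open>D\<close> at t^k
    \<beta>. The relation with \<open>u\<close> prescribes each step, and
    \<open>c \<noteq> 0\<close> makes the step surjective, so the start value 0 extends in both
    directions.\<close>
  have "\<forall>\<beta>. \<exists>f. f 0 = 0 \<and> (\<forall>k. f (k + 1) = scale c (inv u (f k)) + int_iter u k \<beta>)"
  proof
    fix \<beta>
    have "surj (\<lambda>x. scale c (inv u x) + int_iter u k \<beta>)" for k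
    proof (rule surjI)
      show "scale c (inv u (u (scale (inverse c) (y - int_iter u k \<beta>)))) + int_iter u k \<beta> = y" for y
        using c by (simp add: iu)
    qed
    from int_recursion[of "\<lambda>k x. scale c (inv u x) + int_iter u k \<beta>" 0, OF this]
    obtain f where "f 0 = 0" "\<And>k. f (k + 1) = scale c (inv u (f k)) + int_iter u k \<beta>" by blast
    then show "\<exists>f. f 0 = 0 \<and> (\<forall>k. f (k + 1) = scale c (inv u (f k)) + int_iter u k \<beta>)"
      by blast
  qed
  from choice[OF this] obtain \<delta> where \<delta>0: "\<And>\<beta>. \<delta> \<beta> 0 = 0"
    and \<delta>: "\<And>\<beta> k. \<delta> \<beta> (k + 1) = scale c (inv u (\<delta> \<beta> k)) + int_iter u k \<beta>"
    by blast
  interpret vv: vector_space_pair scale scale ..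
  obtain D where lin: "Vector_Spaces.linear scale scale D"
    and De: "\<And>x. x \<in> e ` (UNIV \<times> B) \<Longrightarrow>
      D x = (\<lambda>(k, \<beta>). \<delta> \<beta> k) (the_inv_into (UNIV \<times> B) e x)"
    using vv.linear_independent_extend[OF basis(2),
        where f = "\<lambda>x. (\<lambda>(k, \<beta>). \<delta> \<beta> k) (the_inv_into (UNIV \<times> B) e x)"] by blast
  have D: "D (int_iter u k \<beta>) = \<delta> \<beta> k" if "\<beta> \<in> B" for k \<beta>
    using De[of "e (k, \<beta>)"] that basis(1) by (simp add: the_inv_into_f_f) (simp add: e_def)
  interpret D: Vector_Spaces.linear scale scale D by fact
  have Du: "D (u x) = scale c (inv u (D x)) + x" for x
  proof (rule vv.linear_eq_on[where B = "e ` (UNIV \<times> B)" and x = x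
        and f = "\<lambda>x. D (u x)"])
    show "Vector_Spaces.linear scale scale (\<lambda>x. D (u x))"
      by (rule linearI[OF vs vs]) (simp_all add: u.add u.scale D.add D.scale)
    show "Vector_Spaces.linear scale scale (\<lambda>x. scale c (inv u (D x)) + x)"
      by (rule linearI[OF vs vs])
        (simp_all add: i.add i.scale D.add D.scale v.scale_right_distrib mult.commute)
    show "x \<in> v.span (e ` (UNIV \<times> B))" by (simp add: basis)
    fix y assume "y \<in> e ` (UNIV \<times> B)"
    then obtain k \<beta> where "\<beta> \<in> B" "y = int_iter u k \<beta>" by (auto simp: e_def)
    then show "D (u y) = scale c (inv u (D y)) + y"
      using \<delta>[of \<beta> k] by (simp add: int_iter_succ[OF bij, symmetric] D)
  qed
  \<comment> \<open>Both sides equal \<open>scale c (D (inv u (D x))) + D x\<close>: the left by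
    expanding \<open>D (u x)\<close>, the right by the relation at
    \<open>inv u (D x)\<close>.\<close>
  have commute: "D (D (u x)) = u (D (D x))" for x
  proof -
    have "scale c (D (inv u (D x))) = u (scale c (inv u (D (inv u (D x)))))"
      by (simp add: u.scale ui)
    also have "\<dots> = u (D (D x)) - D x"
      using Du[of "inv u (D x)"] by (simp add: ui u.add)
    finally show ?thesis by (simp add: Du D.add D.scale)
  qed
  have DD: "D (D x) = 0" for x
  proof (rule vv.linear_eq_on[where B = "e ` (UNIV \<times> B)" and x = x
        and f = "\<lambda>x. D (D x)" and g = "\<lambda>_. 0"])
    show "Vector_Spaces.linear scale scale (\<lambda>x. D (D x))"
      by (rule linearI[OF vs vs]) (simp_all add: D.add D.scale)
    show "x \<in> v.span (e ` (UNIV \<times> B))" by (simp add: basis)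
    fix y assume "y \<in> e ` (UNIV \<times> B)"
    then obtain k \<beta> where \<beta>: "\<beta> \<in> B" and y: "y = int_iter u k \<beta>" by (auto simp: e_def)
    have "D (D (int_iter u k \<beta>)) = 0"
    proof (induction k rule: int_induct[where k = 0])
      case base
      show ?case by (simp add: D \<delta>0 \<beta> D.zero)
    next
      case (step1 k)
      then show ?case by (simp add: int_iter_succ[OF bij] commute u.zero)
    next
      case (step2 k)
      \<comment> \<open>Downwards, commutation gives vanishing only after applying \<open>u\<close>,
        which is injective.\<close>
      have "u (D (D (int_iter u (k - 1) \<beta>))) = u 0"
        using step2 int_iter_succ[OF bij, of "k - 1" \<beta>] by (simp add: u.zero flip: commute)
      then show ?case using bij_is_inj[OF bij] by (simp only: inj_eq)
    qed
    then show "D (D y) = 0" by (simp add: y)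
  qed (rule vv.linear_zero)
  show ?thesis using that[OF lin Du DD] .
qed

section \<open>Quadratic relations and the factorization\<close>

lemma poly_endo_eq_zero_quadratic:
  assumes "vector_space scale" "degree p = 2"
    and "\<And>x. f (f x) = scale (- coeff p 1 / coeff p 2) (f x) - scale (coeff p 0 / coeff p 2) x"
  shows "poly_endo scale p f = (\<lambda>_. 0)"
proof
  fix x
  interpret vector_space scale by fact
  have "coeff p 2 \<noteq> 0" using assms(2) by (metis leading_coeff_0_iff degree_0 zero_neq_numeral)
  moreover have "poly_endo scale p f x =
      scale (coeff p 0) x + scale (coeff p 1) (f x) + scale (coeff p 2) (f (f x))"
    by (simp add: poly_endo_def assms(2) numeral_2_eq_2)
  ultimately show "poly_endo scale p f x = 0"
    by (simp add: assms(3) scale_right_diff_distrib)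
qed

text \<open>The relation for \<open>a\<close> comes from showing that \<open>a\<close> plus
  \<open>d\<close> times its inverse is the scalar \<open>s\<close>; this inverse is
  \<open>b \<circ> inv u\<close>.\<close>

lemma quadratic_factorization:
  assumes vs: "vector_space scale" and el: "elementary scale u"
    and d: "d \<noteq> 0" and y: "y\<^sub>1 \<noteq> 0" "y\<^sub>2 \<noteq> 0"
  obtains a b where "Vector_Spaces.linear scale scale a" "Vector_Spaces.linear scale scale b"
    "u = a \<circ> b"
    "\<And>x. a (a x) = scale s (a x) - scale d x"
    "\<And>x. b (b x) = scale (y\<^sub>1 + y\<^sub>2) (b x) - scale (y\<^sub>1 * y\<^sub>2) x"
proof -
  define c where "c = d * (y\<^sub>1 * y\<^sub>2)"
  have c: "c \<noteq> 0" using d y by (simp add: c_def)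
  obtain D where lin: "Vector_Spaces.linear scale scale D"
    and Du: "\<And>x. D (u x) = scale c (inv u (D x)) + x" and DD: "\<And>x. D (D x) = 0"
    using demazure_operator_exists[OF vs el c] by blast
  have u: "automorphism scale u" and bij: "bij u"
    using el by (auto simp: elementary_def automorphism_def)
  define v where "v = inv u"
  interpret V: vector_space scale by fact
  interpret vv: vector_space_pair scale scale ..
  interpret D: Vector_Spaces.linear scale scale D by fact
  interpret u: Vector_Spaces.linear scale scale u using u by (simp add: automorphism_def)
  have uv: "u (v x) = x" and vu: "v (u x) = x" for x
    using bij by (simp_all add: v_def bij_is_surj bij_is_inj surj_f_inv_f)
  have "int_iter u (- 1) = v" by (simp add: int_iter_def v_def)
  then interpret v: Vector_Spaces.linear scale scale v
    using linear_int_iter[OF u, of "- 1"] by simp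
  note Du = Du[folded v_def]
  note hom = D.add D.diff D.scale u.add u.diff u.scale v.add v.diff v.scale
  note expand = hom V.scale_right_distrib V.scale_right_diff_distrib V.scale_left_distrib
    V.scale_left_diff_distrib
  define w where "w x = scale (c * y\<^sub>1) (v x) + scale y\<^sub>2 (u x) - scale (s * (y\<^sub>1 * y\<^sub>2)) x" for x
  define b where "b x = scale y\<^sub>1 x + w (D x)" for x
  \<comment> \<open>\<open>r\<close> is \<open>y\<^sub>1 * y\<^sub>2\<close> times the intended
    \<open>a\<close>: the quadratic relation of \<open>b\<close> makes
    \<open>y\<^sub>1 + y\<^sub>2 - b\<close> equal to \<open>y\<^sub>1 * y\<^sub>2\<close> times the
    inverse of \<open>b\<close>.\<close>
  define r where "r x = u (scale (y\<^sub>1 + y\<^sub>2) x - b x)" for x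
  have DuD: "D (u (D x)) = D x" for x
    by (simp add: Du DD hom)
  \<comment> \<open>The relation at \<open>v (D x)\<close> has left side
    \<open>D (D x) = 0\<close>.\<close>
  have DvD: "scale c (D (v (D x))) = - D x" for x
  proof -
    have "scale c (v (D (v (D x)))) + v (D x) = 0"
      using Du[of "v (D x)"] by (simp add: uv DD)
    from arg_cong[OF this, of u] show ?thesis
      by (simp add: hom uv eq_neg_iff_add_eq_0)
  qed
  \<comment> \<open>The terms of \<open>w\<close> in \<open>v\<close> and \<open>u\<close>
    contribute \<open>- y\<^sub>1\<close> and \<open>y\<^sub>2\<close>; the constant term dies by
    \<open>DD\<close>. Hence \<open>w \<circ> D\<close> has square
    \<open>y\<^sub>2 - y\<^sub>1\<close> times itself, which is the relation of \<open>b\<close>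
    shifted by \<open>y\<^sub>1\<close>.\<close>
  have DwD: "D (w (D x)) = scale (y\<^sub>2 - y\<^sub>1) (D x)" for x
    using arg_cong[OF DvD, of "scale y\<^sub>1" x]
    by (simp add: w_def expand DuD DD mult.commute[of c])
  have w_scale: "w (scale k x) = scale k (w x)" and w_add: "w (x + y) = w x + w y" for k x y
    by (simp_all add: w_def expand mult_ac)
  have b_quadratic: "b (b x) = scale (y\<^sub>1 + y\<^sub>2) (b x) - scale (y\<^sub>1 * y\<^sub>2) x" for x
    by (simp add: b_def expand w_scale w_add DwD algebra_simps)
  have b_lin: "Vector_Spaces.linear scale scale b"
    by (rule linearI[OF vs vs]) (simp_all add: b_def expand w_scale w_add algebra_simps)
  then interpret b: Vector_Spaces.linear scale scale b .
  have rb: "r (b x) = scale (y\<^sub>1 * y\<^sub>2) (u x)" for x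
    by (simp add: r_def b_quadratic hom)
  have br: "b (v (r x)) = scale (y\<^sub>1 * y\<^sub>2) x" for x
    by (simp add: r_def vu b.diff b.scale b_quadratic)
  have cDv: "scale c (D (v x)) = u (D x) - x" for x
    using arg_cong[OF Du[of "v x"], of u] by (simp add: uv hom)
  text \<open>This is the relation \<open>d a\<^sup>-\<^sup>1 + a = s\<close>; it is what determines the choice of \<open>w\<close>.\<close>
  have key: "scale c (b (v x)) + r x = scale (s * (y\<^sub>1 * y\<^sub>2)) x" for x
  proof -
    have "scale c (b (v x)) = scale (c * y\<^sub>1) (v x) + w (u (D x) - x)"
      by (simp add: b_def expand flip: w_scale cDv)
    \<comment> \<open>The terms in \<open>D\<close> cancel because \<open>w\<close> commutes with
      \<open>u\<close>. What remains, \<open>c * y\<^sub>1\<close> times \<open>v\<close> plus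
      \<open>y\<^sub>2\<close> times \<open>u\<close> minus \<open>w\<close>, is a scalar by the
      choice of \<open>w\<close>.\<close>
    then show ?thesis
      by (simp add: r_def b_def w_def expand uv vu algebra_simps)
  qed
  define k where "k = inverse (y\<^sub>1 * y\<^sub>2)"
  have k: "k * (y\<^sub>1 * y\<^sub>2) = 1" unfolding k_def using y by (intro left_inverse) simp
  define a where "a x = scale k (r x)" for x
  have r_hom: "r (scale l x) = scale l (r x)" "r (x + y) = r x + r y" for l x y
    by (simp_all add: r_def b.add b.scale expand algebra_simps)
  have ab: "a (b x) = u x" for x
    using k by (simp add: a_def rb)
  \<comment> \<open>Putting \<open>r x\<close> into \<open>key\<close> amounts, up to scalars, to
    multiplying by \<open>a\<close>; \<open>br\<close> then turns the inverse term into a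
    scalar.\<close>
  have rr: "r (r x) = scale (s * (y\<^sub>1 * y\<^sub>2)) (r x) - scale (c * (y\<^sub>1 * y\<^sub>2)) x" for x
    using key[of "r x"] by (simp add: br algebra_simps)
  have coeffs: "k * (k * (s * (y\<^sub>1 * y\<^sub>2))) = s * k" "k * (k * (c * (y\<^sub>1 * y\<^sub>2))) = d"
    using y by (simp_all add: k_def c_def field_simps)
  have a_quadratic: "a (a x) = scale s (a x) - scale d x" for x
    by (simp add: a_def r_hom rr V.scale_right_diff_distrib coeffs)
  have a_lin: "Vector_Spaces.linear scale scale a"
    by (rule linearI[OF vs vs]) (simp_all add: a_def r_hom V.scale_right_distrib mult.commute)
  show ?thesis
    using that[OF a_lin b_lin _ a_quadratic b_quadratic] ab by (simp add: fun_eq_iff)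
qed

theorem theorem1p10:
  fixes scale :: "'a::field \<Rightarrow> 'b::ab_group_add \<Rightarrow> 'b"
    and p q :: "'a poly"
    and u :: "'b \<Rightarrow> 'b"
  assumes "vector_space scale"
    and "split_poly p" "non_derogatory p" "degree p = 2"
    and "split_poly q" "non_derogatory q" "degree q = 2"
    and "elementary scale u"
  shows "pq_product_endo scale p q u"
proof -
  have lead: "coeff p 2 \<noteq> 0" "coeff q 2 \<noteq> 0"
    using assms(4,7) by (metis leading_coeff_0_iff degree_0 zero_neq_numeral)+
  have const: "coeff p 0 \<noteq> 0" "coeff q 0 \<noteq> 0"
    using assms(3,6) by (simp_all add: non_derogatory_def poly_0_coeff_0)
  obtain m rs where q: "q = smult m (\<Prod>r\<leftarrow>rs. [:- r, 1:])"
    using assms(5) by (auto simp: split_poly_def)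
  \<comment> \<open>An empty \<open>rs\<close> would make \<open>q\<close> constant.\<close>
  have "rs \<noteq> []" using assms(7) q by (auto split: if_splits)
  then obtain y\<^sub>1 where "poly q y\<^sub>1 = 0" using q by (cases rs) auto
  then have root: "coeff q 0 + coeff q 1 * y\<^sub>1 + coeff q 2 * y\<^sub>1\<^sup>2 = 0"
    by (simp add: poly_altdef assms(7) numeral_2_eq_2)
  \<comment> \<open>The second root is defined through Vieta's sum; the product formula then follows
    from \<open>y\<^sub>1\<close> being a root, and \<open>q\<close> not vanishing at 0 makes both
    roots nonzero.\<close>
  define y\<^sub>2 where "y\<^sub>2 = - coeff q 1 / coeff q 2 - y\<^sub>1"
  have sum: "y\<^sub>1 + y\<^sub>2 = - coeff q 1 / coeff q 2" by (simp add: y\<^sub>2_def)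
  have "coeff q 2 * (y\<^sub>1 * y\<^sub>2) = - coeff q 1 * y\<^sub>1 - coeff q 2 * y\<^sub>1\<^sup>2"
    using lead by (simp add: y\<^sub>2_def field_simps power2_eq_square)
  also have "\<dots> = coeff q 0"
    using root by algebra
  finally have prod: "y\<^sub>1 * y\<^sub>2 = coeff q 0 / coeff q 2"
    using lead by (simp add: field_simps)
  have y: "y\<^sub>1 \<noteq> 0" "y\<^sub>2 \<noteq> 0" using prod const lead by auto
  have "coeff p 0 / coeff p 2 \<noteq> 0" using const lead by simp
  from quadratic_factorization[OF assms(1,8) this y, where s = "- coeff p 1 / coeff p 2"]
  obtain a b where "Vector_Spaces.linear scale scale a" "Vector_Spaces.linear scale scale b"
    "u = a \<circ> b"
    "\<And>x. a (a x) = scale (- coeff p 1 / coeff p 2) (a x) - scale (coeff p 0 / coeff p 2) x"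
    "\<And>x. b (b x) = scale (- coeff q 1 / coeff q 2) (b x) - scale (coeff q 0 / coeff q 2) x"
    unfolding sum prod by blast
  with poly_endo_eq_zero_quadratic[OF assms(1)] assms(4,7) show ?thesis
    unfolding pq_product_endo_def by blast
qed

end
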